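(* Let $R$ be a $4$-curvature operator. Then $R$ is sectionally positive (respectively nonnegative) if and only if for every critical point $(x_1,y_1)\in\mathbb{R}^2$ of $R$, the number $x_1$ is positive (respectively nonnegative).
   Context: Work on $\mathbb{R}^4$ with its standard inner product and orientation. $\Lambda^2$ is the $6$-dimensional space of $2$-forms, with the inner product for which $e_a\wedge e_b$ ($a<b$) is orthonormal. A $4$-curvature operator is a Riemann curvature tensor $R_{abcd}$ in dimension $4$ (with the usual symmetries) regarded as a self-adjoint operator on $\Lambda^2$; write $vRv=\langle v,Rv\rangle$. $I$ is the identity on $\Lambda^2$ and $K$ is the operator on $\Lambda^2$ given by the $4$-volume form (the Hodge star on $\Lambda^2(\mathbb{R}^4)$, eigenvalues $\pm1$ each of multiplicity $3$). Let $S_2$ be the set of decomposable $2$-forms of norm $1$ (those $v$ with $\langle v,v\rangle=1$ and $v=A\wedge B$ for some $1$-forms $A,B$). $R$ is sectionally positive (nonnegative) if $vRv>0$ ($vRv\geq0$) for all $v\in S_2$. Critical points of $R$: given $(x_1,y_1)\in\mathbb{R}^2$, expand $$\det\big((R-x_1I-y_1K)-xI-yK\big)=\sum_{m,n}a_{mn}x^my^n,\qquad P_k(x,y)=\sum_{m+n=k}a_{mn}x^my^n,$$ and let $k$ be the smallest index with $P_k\neq0$. The point $(x_1,y_1)$ is a critical point of $R$ if the coefficients $a_{k0},a_{k-1,1},\dots,a_{0k}$ of $P_k(x,1)$ are neither all of the same strict sign (all positive or all negative) nor strictly alternating in sign (all nonzero with consecutive ones of opposite sign). When $k=0$ the single nonzero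 coefficient counts as "all of the same sign", so $(x_1,y_1)$ is not critical. *)

theory Defs
  imports "HOL-Analysis.Analysis" "HOL-Computational_Algebra.Polynomial"
begin

text \<open>
  The index set of the basis \<open>e\<^sub>a \<and> e\<^sub>b\<close> (\<open>a < b\<close>) of the 2-forms on \<open>real ^ 4\<close>. The pairs are listed
  explicitly because in the type \<open>4\<close> the numeral \<open>4\<close> equals \<open>0\<close>, so that the order of that type is
  not the order 1, 2, 3, 4 of the standard basis.
\<close>

typedef idx2 = "{(1,2), (1,3), (1,4), (2,3), (2,4), (3,4)} :: (4 \<times> 4) set"
  by blast

instance idx2 :: finite
proof
  have "(UNIV :: idx2 set) = Abs_idx2 ` {(1,2), (1,3), (1,4), (2,3), (2,4), (3,4)}"
    using type_definition.Abs_image[OF type_definition_idx2] by simp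
  then show "finite (UNIV :: idx2 set)"
    by (metis finite.emptyI finite_imageI finite_insert)
qed

definition idx_fst :: "idx2 \<Rightarrow> 4" where
  "idx_fst p = fst (Rep_idx2 p)"

definition idx_snd :: "idx2 \<Rightarrow> 4" where
  "idx_snd p = snd (Rep_idx2 p)"

text \<open>The inner product of \<open>real ^ idx2\<close> is the one for which the \<open>e\<^sub>a \<and> e\<^sub>b\<close> are orthonormal.\<close>

type_synonym form2 = "real ^ idx2"

type_synonym operator2 = "real ^ idx2 ^ idx2"

definition wedge :: "real ^ 4 \<Rightarrow> real ^ 4 \<Rightarrow> form2" where
  "wedge A B = (\<chi> p. A $ idx_fst p * B $ idx_snd p - A $ idx_snd p * B $ idx_fst p)"

definition S2 :: "form2 set" where
  "S2 = {v. v \<bullet> v = 1 \<and> (\<exists>A B. v = wedge A B)}"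

definition curvature_tensor :: "(4 \<Rightarrow> 4 \<Rightarrow> 4 \<Rightarrow> 4 \<Rightarrow> real) \<Rightarrow> bool" where
  "curvature_tensor T \<longleftrightarrow>
     (\<forall>a b c d. T a b c d = - T b a c d) \<and>
     (\<forall>a b c d. T a b c d = - T a b d c) \<and>
     (\<forall>a b c d. T a b c d = T c d a b) \<and>
     (\<forall>a b c d. T a b c d + T a c d b + T a d b c = 0)"

text \<open>
  Sign and normalisation: \<open>\<langle>e\<^sub>a \<and> e\<^sub>b, R (e\<^sub>c \<and> e\<^sub>d)\<rangle> = R\<^sub>a\<^sub>b\<^sub>c\<^sub>d\<close>, so that the unit sphere, with
  \<open>R\<^sub>a\<^sub>b\<^sub>a\<^sub>b = 1\<close>, has the identity as its curvature operator.
\<close>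

definition operator_of_tensor :: "(4 \<Rightarrow> 4 \<Rightarrow> 4 \<Rightarrow> 4 \<Rightarrow> real) \<Rightarrow> operator2" where
  "operator_of_tensor T = (\<chi> p q. T (idx_fst p) (idx_snd p) (idx_fst q) (idx_snd q))"

definition curvature_operator :: "operator2 \<Rightarrow> bool" where
  "curvature_operator R \<longleftrightarrow> (\<exists>T. curvature_tensor T \<and> R = operator_of_tensor T)"

definition sectionally_positive :: "operator2 \<Rightarrow> bool" where
  "sectionally_positive R \<longleftrightarrow> (\<forall>v\<in>S2. v \<bullet> (R *v v) > 0)"

definition sectionally_nonnegative :: "operator2 \<Rightarrow> bool" where
  "sectionally_nonnegative R \<longleftrightarrow> (\<forall>v\<in>S2. v \<bullet> (R *v v) \<ge> 0)"

definition volume_form :: "real ^ 4 \<Rightarrow> real ^ 4 \<Rightarrow> real ^ 4 \<Rightarrow> real ^ 4 \<Rightarrow> real" where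
  "volume_form u v w z = det (vector [u, v, w, z] :: real ^ 4 ^ 4)"

text \<open>The Hodge star on 2-forms: \<open>\<langle>e\<^sub>a \<and> e\<^sub>b, K (e\<^sub>c \<and> e\<^sub>d)\<rangle>\<close> is the volume form at \<open>e\<^sub>a, e\<^sub>b, e\<^sub>c, e\<^sub>d\<close>.\<close>

definition hodge :: operator2 where
  "hodge = (\<chi> p q. volume_form (axis (idx_fst p) 1) (axis (idx_snd p) 1)
                               (axis (idx_fst q) 1) (axis (idx_snd q) 1))"

text \<open>
  \<open>det (M - x I - y K)\<close> as a polynomial in \<open>x\<close> and \<open>y\<close>, namely as a polynomial in \<open>x\<close> whose
  coefficients are polynomials in \<open>y\<close>.
\<close>

definition det_poly :: "operator2 \<Rightarrow> real poly poly" where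
  "det_poly M = det (\<chi> p q. [:[:M $ p $ q, - (hodge $ p $ q):], [:- (mat 1 :: operator2) $ p $ q:]:])"

lemma poly_det: "poly (det A) x = det (\<chi> i j. poly (A $ i $ j) x)"
  for A :: "'a::comm_ring_1 poly ^ 'n ^ 'n"
  by (simp add: det_def poly_sum poly_prod of_int_poly)

lemma poly_det_poly:
  "poly (poly (det_poly M) [:x:]) y = det (M - x *\<^sub>R mat 1 - y *\<^sub>R hodge)"
  unfolding det_poly_def poly_det
  by (rule arg_cong[where f = det]) (simp add: vec_eq_iff algebra_simps)

definition coeff2 :: "real poly poly \<Rightarrow> nat \<Rightarrow> nat \<Rightarrow> real" where
  "coeff2 p m n = coeff (coeff p m) n"

definition hom_part :: "nat \<Rightarrow> real poly poly \<Rightarrow> real poly poly" where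
  "hom_part k p = (\<Sum>m\<le>k. monom (monom (coeff2 p m (k - m)) (k - m)) m)"

definition lowest_degree :: "real poly poly \<Rightarrow> nat" where
  "lowest_degree p = (LEAST k. hom_part k p \<noteq> 0)"

definition all_same_sign :: "nat \<Rightarrow> (nat \<Rightarrow> real) \<Rightarrow> bool" where
  "all_same_sign k c \<longleftrightarrow> (\<forall>j\<le>k. c j > 0) \<or> (\<forall>j\<le>k. c j < 0)"

definition strictly_alternating :: "nat \<Rightarrow> (nat \<Rightarrow> real) \<Rightarrow> bool" where
  "strictly_alternating k c \<longleftrightarrow> (\<forall>j\<le>k. c j \<noteq> 0) \<and> (\<forall>j<k. sgn (c (Suc j)) = - sgn (c j))"

definition critical_point :: "operator2 \<Rightarrow> real \<Rightarrow> real \<Rightarrow> bool" where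
  "critical_point R x1 y1 \<longleftrightarrow>
     (let D = det_poly (R - x1 *\<^sub>R mat 1 - y1 *\<^sub>R hodge);
          k = lowest_degree D;
          c = (\<lambda>j. coeff2 D (k - j) j)
      in \<not> all_same_sign k c \<and> \<not> strictly_alternating k c)"

end

theory Submission
  imports Defs
begin

text \<open>
  Critical points are stationary values. Write \<open>K\<close> for the Hodge star. A 2-form \<open>v\<close> is
  decomposable iff \<open>\<langle>v, K v\<rangle> = 0\<close> (\<open>decomposable_iff\<close>), so \<open>S2\<close> is the compact set cut out by
  \<open>\<langle>v, v\<rangle> = 1\<close> and \<open>\<langle>v, K v\<rangle> = 0\<close>. The claim is that \<open>(x\<^sub>1, y\<^sub>1)\<close> is critical iff some \<open>v \<in> S2\<close> satisfies
  the Lagrange equation \<open>R v = x\<^sub>1 v + y\<^sub>1 K v\<close> (\<open>critical_point_iff\<close>). For such \<open>v\<close> the number \<open>x\<^sub>1\<close> is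
  the sectional curvature \<open>\<langle>v, R v\<rangle>\<close>, so a lower bound for the sectional curvature bounds all the
  \<open>x\<^sub>1\<close>. Conversely \<open>\<langle>v, R v\<rangle>\<close> attains its minimum on \<open>S2\<close>, the minimiser satisfies the Lagrange
  equation (\<open>minimiser_on_S2\<close>), and hence the minimum is itself one of the \<open>x\<^sub>1\<close>.

  To recognise the Lagrange equation in the determinant, let \<open>N\<close> be the kernel of
  \<open>M = R - x\<^sub>1 I - y\<^sub>1 K\<close>, of dimension \<open>d\<close>. The part of \<open>det (M - x I - y K)\<close> of lowest degree has degree
  \<open>d\<close> and equals, up to a nonzero constant, \<open>\<Prod>(x + \<kappa>\<^sub>i y)\<close>, where the \<open>\<kappa>\<^sub>i\<close> are the eigenvalues of the
  compression of \<open>K\<close> to \<open>N\<close> (\<open>lowest_part_det_poly\<close>). Its coefficients have constant sign iff all \<open>\<kappa>\<^sub>i\<close>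
  are positive, and alternate iff all are negative (\<open>all_same_sign_prod_linear\<close>,
  \<open>strictly_alternating_prod_linear\<close>). Neither happens iff \<open>K\<close> is not definite on \<open>N\<close>, that is, iff
  \<open>N\<close> contains a unit vector with \<open>\<langle>v, K v\<rangle> = 0\<close> (\<open>null_vector_iff\<close>).
\<close>

section \<open>Decomposable 2-forms and the Hodge star\<close>

lemma vector_4:
  "(vector [x,y,z,w] :: 'a::zero^4) $ 1 = x"
  "(vector [x,y,z,w] :: 'a::zero^4) $ 2 = y"
  "(vector [x,y,z,w] :: 'a::zero^4) $ 3 = z"
  "(vector [x,y,z,w] :: 'a::zero^4) $ 4 = w"
  unfolding vector_def by simp_all

lemma det_4: "det (A::'a::comm_ring_1^4^4) =
   A$1$1 * (A$2$2 * A$3$3 * A$4$4 + A$2$3 * A$3$4 * A$4$2 + A$2$4 * A$3$2 * A$4$3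
          - A$2$2 * A$3$4 * A$4$3 - A$2$3 * A$3$2 * A$4$4 - A$2$4 * A$3$3 * A$4$2)
 - A$1$2 * (A$2$1 * A$3$3 * A$4$4 + A$2$3 * A$3$4 * A$4$1 + A$2$4 * A$3$1 * A$4$3
          - A$2$1 * A$3$4 * A$4$3 - A$2$3 * A$3$1 * A$4$4 - A$2$4 * A$3$3 * A$4$1)
 + A$1$3 * (A$2$1 * A$3$2 * A$4$4 + A$2$2 * A$3$4 * A$4$1 + A$2$4 * A$3$1 * A$4$2
          - A$2$1 * A$3$4 * A$4$2 - A$2$2 * A$3$1 * A$4$4 - A$2$4 * A$3$2 * A$4$1)
 - A$1$4 * (A$2$1 * A$3$2 * A$4$3 + A$2$2 * A$3$3 * A$4$1 + A$2$3 * A$3$1 * A$4$2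
          - A$2$1 * A$3$3 * A$4$2 - A$2$2 * A$3$1 * A$4$3 - A$2$3 * A$3$2 * A$4$1)"
proof -
  have f1234: "finite {2::4, 3, 4}" "1 \<notin> {2::4, 3, 4}" by auto
  have f234: "finite {3::4, 4}" "2 \<notin> {3::4, 4}" by auto
  have f34: "finite {4::4}" "3 \<notin> {4::4}" by auto
  show ?thesis
    unfolding det_def UNIV_4
    unfolding sum_over_permutations_insert[OF f1234]
    unfolding sum_over_permutations_insert[OF f234]
    unfolding sum_over_permutations_insert[OF f34]
    unfolding permutes_sing
    by (simp add: sign_swap_id permutation_swap_id sign_compose sign_id transpose_def permutation_compose algebra_simps)
qed

definition index2 :: "4 \<Rightarrow> 4 \<Rightarrow> idx2" where "index2 a b = Abs_idx2 (a,b)"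

lemma idx_index2: "idx_fst (index2 1 2) = 1" "idx_snd (index2 1 2) = 2"
 "idx_fst (index2 1 3) = 1" "idx_snd (index2 1 3) = 3"
 "idx_fst (index2 1 4) = 1" "idx_snd (index2 1 4) = 4"
 "idx_fst (index2 2 3) = 2" "idx_snd (index2 2 3) = 3"
 "idx_fst (index2 2 4) = 2" "idx_snd (index2 2 4) = 4"
 "idx_fst (index2 3 4) = 3" "idx_snd (index2 3 4) = 4"
  by (simp_all add: idx_fst_def idx_snd_def index2_def Abs_idx2_inverse)

lemma UNIV_idx2: "UNIV = {index2 1 2, index2 1 3, index2 1 4, index2 2 3, index2 2 4, index2 3 4}"
  using type_definition.Abs_image[OF type_definition_idx2] by (simp add: index2_def)

lemma index2_distinct:
  "index2 1 2 \<noteq> index2 1 3" "index2 1 2 \<noteq> index2 1 4" "index2 1 2 \<noteq> index2 2 3" "index2 1 2 \<noteq> index2 2 4"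
  "index2 1 2 \<noteq> index2 3 4"
  "index2 1 3 \<noteq> index2 1 4" "index2 1 3 \<noteq> index2 2 3" "index2 1 3 \<noteq> index2 2 4" "index2 1 3 \<noteq> index2 3 4"
  "index2 1 4 \<noteq> index2 2 3" "index2 1 4 \<noteq> index2 2 4" "index2 1 4 \<noteq> index2 3 4"
  "index2 2 3 \<noteq> index2 2 4" "index2 2 3 \<noteq> index2 3 4" "index2 2 4 \<noteq> index2 3 4"
  by (simp_all add: index2_def Abs_idx2_inject)

lemma sum_idx2:
  "sum f UNIV = f (index2 1 2) + f (index2 1 3) + f (index2 1 4) + f (index2 2 3) + f (index2 2 4) + f (index2 3 4)"
  for f :: "idx2 \<Rightarrow> 'a::comm_monoid_add"
  unfolding UNIV_idx2 using index2_distinct by (simp add: ac_simps)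

lemma forall_idx2:
  "(\<forall>p. P p) \<longleftrightarrow> P (index2 1 2) \<and> P (index2 1 3) \<and> P (index2 1 4) \<and> P (index2 2 3) \<and> P (index2 2 4) \<and> P (index2 3 4)"
  using UNIV_idx2 by (metis UNIV_I insertE singletonD)

text \<open>
  The star exchanges complementary index pairs; the minus sign belongs to the pair of \<open>13\<close> and \<open>24\<close>,
  since \<open>1324\<close> is an odd permutation.
\<close>

lemma hodge_mult:
  "(hodge *v v) $ index2 1 2 = v $ index2 3 4"
  "(hodge *v v) $ index2 1 3 = - v $ index2 2 4"
  "(hodge *v v) $ index2 1 4 = v $ index2 2 3"
  "(hodge *v v) $ index2 2 3 = v $ index2 1 4"
  "(hodge *v v) $ index2 2 4 = - v $ index2 1 3"
  "(hodge *v v) $ index2 3 4 = v $ index2 1 2"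
  unfolding matrix_vector_mult_def hodge_def volume_form_def
  by (simp_all add: sum_idx2 idx_index2 det_4 vector_4 axis_def)

lemma hodge_symmetric: "(hodge *v v) \<bullet> w = v \<bullet> (hodge *v w)"
  by (simp add: inner_vec_def sum_idx2 hodge_mult)

lemma hodge_hodge: "hodge *v (hodge *v v) = v"
  by (simp add: vec_eq_iff forall_idx2 hodge_mult)

lemma hodge_plucker:
  "v \<bullet> (hodge *v v) = 2 * (v $ index2 1 2 * v $ index2 3 4 - v $ index2 1 3 * v $ index2 2 4 + v $ index2 1 4 * v $ index2 2 3)"
  by (simp add: inner_vec_def sum_idx2 hodge_mult)

text \<open>
  The Pluecker criterion: \<open>\<langle>v, K v\<rangle>\<close> is the coefficient of \<open>v \<and> v\<close>. If it vanishes, then contracting \<open>v\<close>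
  with \<open>e\<^sub>a\<close> and with \<open>e\<^sub>b\<close> gives two 1-forms whose wedge is \<open>v\<^sub>a\<^sub>b v\<close>, so that any nonzero
  coefficient \<open>v\<^sub>a\<^sub>b\<close> yields a factorisation of \<open>v\<close>.
\<close>

lemma decomposable_iff: "(\<exists>A B. v = wedge A B) \<longleftrightarrow> v \<bullet> (hodge *v v) = 0"
proof
  assume "\<exists>A B. v = wedge A B"
  then show "v \<bullet> (hodge *v v) = 0"
    by (auto simp: hodge_plucker wedge_def idx_index2 algebra_simps)
next
  assume "v \<bullet> (hodge *v v) = 0"
  then have P: "v $ index2 1 2 * v $ index2 3 4 - v $ index2 1 3 * v $ index2 2 4 + v $ index2 1 4 * v $ index2 2 3 = 0"
    by (simp add: hodge_plucker)
  \<comment> \<open>\<open>F a\<close> is the contraction of \<open>v\<close> with \<open>e\<^sub>a\<close>.\<close>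
  define F :: "4 \<Rightarrow> real^4" where "F a = (if a = 1 then vector [0, v $ index2 1 2, v $ index2 1 3, v $ index2 1 4]
    else if a = 2 then vector [- v $ index2 1 2, 0, v $ index2 2 3, v $ index2 2 4]
    else if a = 3 then vector [- v $ index2 1 3, - v $ index2 2 3, 0, v $ index2 3 4]
    else vector [- v $ index2 1 4, - v $ index2 2 4, - v $ index2 3 4, 0])" for a
  have step: "wedge (F (idx_fst p)) (F (idx_snd p)) = (v $ p) *\<^sub>R v" for p
  proof -
    have "\<forall>p. wedge (F (idx_fst p)) (F (idx_snd p)) = (v $ p) *\<^sub>R v"
      using P by (auto simp add: forall_idx2 vec_eq_iff wedge_def idx_index2 F_def vector_4 algebra_simps)
    then show ?thesis by blast
  qed
  show "\<exists>A B. v = wedge A B"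
  proof (cases "v = 0")
    case True
    then have "v = wedge 0 0" by (simp add: wedge_def vec_eq_iff)
    then show ?thesis by blast
  next
    case False
    then obtain p where p: "v $ p \<noteq> 0" by (auto simp: vec_eq_iff)
    have "wedge ((1 / v $ p) *\<^sub>R F (idx_fst p)) (F (idx_snd p)) = (1 / v $ p) *\<^sub>R wedge (F (idx_fst p)) (F (idx_snd p))"
      by (simp add: wedge_def vec_eq_iff algebra_simps)
    also have "\<dots> = v" using p by (simp add: step)
    finally show ?thesis by metis
  qed
qed

lemma curvature_operator_symmetric:
  assumes "curvature_operator R" shows "v \<bullet> (R *v w) = (R *v v) \<bullet> w"
proof -
  obtain T where T: "curvature_tensor T" and R: "R = operator_of_tensor T"
    using assms by (auto simp: curvature_operator_def)
  have "T a b c d = T c d a b" for a b c d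
    using T unfolding curvature_tensor_def by blast
  then have "R $ p $ q = R $ q $ p" for p q
    unfolding R operator_of_tensor_def vec_lambda_beta .
  then have "transpose R = R" by (simp add: transpose_def vec_eq_iff)
  then show ?thesis by (metis dot_lmul_matrix vector_transpose_matrix)
qed

section \<open>Simultaneous diagonalisation of symmetric forms\<close>

text \<open>
  First-order condition along a curve. Degree four suffices: below, a quadratic form is evaluated on
  curves that are at most quadratic in the parameter.
\<close>

lemma quartic_min_at_zero:
  fixes a :: real
  assumes "\<And>t. 0 \<le> a * t + b * t^2 + c * t^3 + d * t^4"
  shows "a = 0"
proof -
  have "((\<lambda>t. a * t + b * t^2 + c * t^3 + d * t^4) has_real_derivative a) (at 0)"
    by (auto intro!: derivative_eq_intros)
  then show ?thesis
    using assms by (intro DERIV_local_min[where d = 1]) auto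
qed

lemma rayleigh_minimum:
  fixes f :: "'a::euclidean_space \<Rightarrow> 'a"
  assumes lin: "linear f" and S: "subspace S" "S \<noteq> {0}"
  obtains u where "u \<in> S" "norm u = 1" "\<And>w. w \<in> S \<Longrightarrow> (u \<bullet> f u) * (w \<bullet> w) \<le> w \<bullet> f w"
proof -
  have "compact (S \<inter> sphere 0 1)"
    using S by (simp add: closed_Int_compact closed_subspace)
  moreover have "S \<inter> sphere 0 1 \<noteq> {}"
  proof -
    obtain v where "v \<in> S" "v \<noteq> 0"
      using S subspace_0 by blast
    then have "v /\<^sub>R norm v \<in> S \<inter> sphere 0 1"
      using S by (simp add: subspace_scale)
    then show ?thesis by blast
  qed
  moreover have "continuous_on (S \<inter> sphere 0 1) (\<lambda>v. v \<bullet> f v)"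
    using lin by (intro continuous_intros linear_continuous_on) (simp add: linear_conv_bounded_linear)
  ultimately have "\<exists>u\<in>S \<inter> sphere 0 1. \<forall>w\<in>S \<inter> sphere 0 1. u \<bullet> f u \<le> w \<bullet> f w"
    by (rule continuous_attains_inf)
  then obtain u where u: "u \<in> S \<inter> sphere 0 1"
    and min: "\<And>w. w \<in> S \<inter> sphere 0 1 \<Longrightarrow> u \<bullet> f u \<le> w \<bullet> f w"
    by blast
  have "(u \<bullet> f u) * (w \<bullet> w) \<le> w \<bullet> f w" if "w \<in> S" for w
  proof (cases "w = 0")
    case False
    then have "w /\<^sub>R norm w \<in> S \<inter> sphere 0 1"
      using S that by (simp add: subspace_scale)
    then have "u \<bullet> f u \<le> (w /\<^sub>R norm w) \<bullet> f (w /\<^sub>R norm w)"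
      by (rule min)
    also have "\<dots> = (w \<bullet> f w) / (w \<bullet> w)"
      using lin by (simp add: linear_scale power2_norm_eq_inner[symmetric] power2_eq_square divide_simps)
    finally show ?thesis
      using False by (simp add: field_simps)
  qed (use lin in simp)
  then show ?thesis using that u by auto
qed

text \<open>
  A unit vector \<open>u\<close> of \<open>S\<close> that minimises the form is conjugate to every vector of \<open>S\<close> orthogonal to it,
  because the form has zero derivative at \<open>u\<close> in that direction; then continue in the orthogonal
  complement of \<open>u\<close> in \<open>S\<close>. Only values of the form on \<open>S\<close> enter, so what is diagonalised is the
  compression of the operator to \<open>S\<close>.
\<close>

lemma symmetric_form_orthonormal_diagonalization:
  fixes f :: "'a::euclidean_space \<Rightarrow> 'a"
  assumes lin: "linear f" and sym: "\<And>x y. f x \<bullet> y = x \<bullet> f y" and "subspace S"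
  shows "\<exists>B\<subseteq>S. pairwise orthogonal B \<and> (\<forall>b\<in>B. norm b = 1) \<and> span B = S
    \<and> (\<forall>b\<in>B. \<forall>c\<in>B. b \<noteq> c \<longrightarrow> b \<bullet> f c = 0)"
  using \<open>subspace S\<close>
proof (induction "dim S" arbitrary: S rule: less_induct)
  case less
  show ?case
  proof (cases "S = {0}")
    case True
    then show ?thesis by (intro exI[of _ "{}"]) simp
  next
    case False
    then obtain u where u: "u \<in> S" "norm u = 1"
      and min: "\<And>w. w \<in> S \<Longrightarrow> (u \<bullet> f u) * (w \<bullet> w) \<le> w \<bullet> f w"
      using rayleigh_minimum[OF lin less.prems] by metis
    have uu: "u \<bullet> u = 1" using u by (simp add: norm_eq_1)
    define T where "T = {w \<in> S. u \<bullet> w = 0}"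
    have conj: "u \<bullet> f w = 0" if "w \<in> T" for w
    proof -
      have w: "w \<in> S" "u \<bullet> w = 0" "w \<bullet> u = 0" using that by (auto simp: T_def inner_commute)
      have wfu: "w \<bullet> f u = u \<bullet> f w" using sym[of u w] by (simp add: inner_commute)
      have "0 \<le> (2 * (u \<bullet> f w)) * t + (w \<bullet> f w - (u \<bullet> f u) * (w \<bullet> w)) * t^2 + 0 * t^3 + 0 * t^4" for t
      proof -
        have "u + t *\<^sub>R w \<in> S" using u w less.prems by (simp add: subspace_add subspace_scale)
        from min[OF this] show ?thesis
          using w uu wfu lin
          by (simp add: linear_add linear_scale inner_add_left inner_add_right algebra_simps power2_eq_square)
      qed
      then have "2 * (u \<bullet> f w) = 0" by (rule quartic_min_at_zero)
      then show ?thesis by simp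
    qed
    have T: "subspace T"
      using less.prems unfolding T_def subspace_def by (auto simp: inner_add_right)
    have "u \<notin> T" using uu by (simp add: T_def)
    then have "T \<subset> S" using u(1) unfolding T_def by blast
    then have "dim T < dim S"
      using T less.prems by (intro dim_psubset) (metis span_eq_iff)
    from less.hyps[OF this T] obtain B where B: "B \<subseteq> T" "pairwise orthogonal B" "\<forall>b\<in>B. norm b = 1" "span B = T"
      "\<forall>b\<in>B. \<forall>c\<in>B. b \<noteq> c \<longrightarrow> b \<bullet> f c = 0"
      by (elim exE conjE) (rule that)
    have "span (insert u B) = S"
    proof
      show "span (insert u B) \<subseteq> S"
        using B(1) u(1) \<open>T \<subset> S\<close> less.prems by (intro span_minimal) blast+
      show "S \<subseteq> span (insert u B)"
      proof
        fix x assume "x \<in> S"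
        then have "x - (x \<bullet> u) *\<^sub>R u \<in> T"
          using u uu less.prems by (simp add: T_def subspace_diff subspace_scale inner_diff_right inner_commute)
        then show "x \<in> span (insert u B)"
          using B(4) span_breakdown_eq by blast
      qed
    qed
    moreover have "pairwise orthogonal (insert u B)"
    proof -
      have "u \<bullet> b = 0" if "b \<in> B" for b using that B(1) by (auto simp: T_def)
      then show ?thesis using B(2) by (simp add: pairwise_insert orthogonal_def inner_commute)
    qed
    moreover have "\<forall>b\<in>insert u B. \<forall>c\<in>insert u B. b \<noteq> c \<longrightarrow> b \<bullet> f c = 0"
    proof (intro ballI impI)
      fix b c assume bc: "b \<in> insert u B" "c \<in> insert u B" "b \<noteq> c"
      have cu: "b \<bullet> f u = 0" if "b \<in> T" for b
        using conj[OF that] sym[of b u] by (simp add: inner_commute)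
      consider "b = u" "c \<in> B" | "c = u" "b \<in> B" | "b \<in> B" "c \<in> B" using bc by blast
      then show "b \<bullet> f c = 0"
      proof cases
        case 1 then show ?thesis using conj[of c] B(1) by blast
      next
        case 2 then show ?thesis using cu[of b] B(1) by blast
      next
        case 3 then show ?thesis using B(5) bc(3) by blast
      qed
    qed
    moreover have "insert u B \<subseteq> S" using B(1) u(1) \<open>T \<subset> S\<close> by blast
    moreover have "\<forall>b\<in>insert u B. norm b = 1" using B(3) u(2) by blast
    ultimately show ?thesis by (intro exI[of _ "insert u B"] conjI)
  qed
qed

text \<open>
  Let \<open>M\<close> be self-adjoint. The vectors \<open>b i\<close> with \<open>i \<in> J\<close> span the kernel of \<open>M\<close> and diagonalise the
  compression of \<open>K\<close> to it; the other vectors are eigenvectors of \<open>M\<close> for nonzero eigenvalues. In such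
  a basis the rows of \<open>M - x I - y K\<close> with index in \<open>J\<close> are homogeneous of degree one in \<open>(x, y)\<close>, and the
  remaining rows are diagonal up to terms that vanish at the origin.
\<close>

definition adapted_basis :: "real^'n^'n \<Rightarrow> real^'n^'n \<Rightarrow> ('n \<Rightarrow> real^'n) \<Rightarrow> 'n set \<Rightarrow> bool" where
  "adapted_basis M K b J \<longleftrightarrow>
     (\<forall>i j. b i \<bullet> b j = (if i = j then 1 else 0)) \<and>
     {v. M *v v = 0} = span (b ` J) \<and>
     (\<forall>i\<in>J. \<forall>j\<in>J. i \<noteq> j \<longrightarrow> b i \<bullet> (K *v b j) = 0) \<and>
     (\<forall>i. i \<notin> J \<longrightarrow> b i \<bullet> (M *v b i) \<noteq> 0) \<and>
     (\<forall>i j. i \<notin> J \<longrightarrow> i \<noteq> j \<longrightarrow> b i \<bullet> (M *v b j) = 0)"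

lemma adapted_basisD:
  assumes "adapted_basis M K b J"
  shows "b i \<bullet> b j = (if i = j then 1 else 0)"
    and "{v. M *v v = 0} = span (b ` J)"
    and "\<lbrakk>i \<in> J; j \<in> J; i \<noteq> j\<rbrakk> \<Longrightarrow> b i \<bullet> (K *v b j) = 0"
    and "i \<notin> J \<Longrightarrow> b i \<bullet> (M *v b i) \<noteq> 0"
    and "\<lbrakk>i \<notin> J; i \<noteq> j\<rbrakk> \<Longrightarrow> b i \<bullet> (M *v b j) = 0"
  using assms by (simp_all add: adapted_basis_def)

lemma adapted_basis_kernel:
  assumes "adapted_basis M K b J" "i \<in> J"
  shows "M *v b i = 0"
proof -
  have "b i \<in> span (b ` J)" using assms(2) by (simp add: span_base)
  then show ?thesis unfolding adapted_basisD(2)[OF assms(1), symmetric] by simp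
qed

text \<open>
  Diagonalise \<open>K\<close> on the kernel \<open>N\<close> of \<open>M\<close>, and \<open>M\<close> on the orthogonal complement of \<open>N\<close>. As \<open>M\<close> is
  self-adjoint, its range is orthogonal to \<open>N\<close>, so the diagonal entries off \<open>N\<close> cannot vanish: a basis
  vector with zero entry would be mapped to a vector orthogonal to the whole basis, hence lie in \<open>N\<close>.
\<close>

lemma adapted_basis_exists:
  fixes M K :: "real^'n^'n"
  assumes M: "\<And>x y. (M *v x) \<bullet> y = x \<bullet> (M *v y)" and K: "\<And>x y. (K *v x) \<bullet> y = x \<bullet> (K *v y)"
  shows "\<exists>b J. adapted_basis M K b J"
proof -
  define N where "N = {v. M *v v = 0}"
  have N: "subspace N"
    by (auto simp: N_def subspace_def matrix_vector_right_distrib matrix_vector_mult_scaleR)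
  define P where "P = {w. \<forall>v\<in>N. orthogonal v w}"
  have P: "subspace P" unfolding P_def by (rule subspace_orthogonal_to_vectors)
  obtain B where B: "B \<subseteq> N" "pairwise orthogonal B" "\<forall>b\<in>B. norm b = 1" "span B = N"
      "\<forall>b\<in>B. \<forall>c\<in>B. b \<noteq> c \<longrightarrow> b \<bullet> (K *v c) = 0"
    using symmetric_form_orthonormal_diagonalization[OF matrix_vector_mul_linear K N]
    by (elim exE conjE) (rule that)
  obtain C where C: "C \<subseteq> P" "pairwise orthogonal C" "\<forall>b\<in>C. norm b = 1" "span C = P"
      "\<forall>b\<in>C. \<forall>c\<in>C. b \<noteq> c \<longrightarrow> b \<bullet> (M *v c) = 0"
    using symmetric_form_orthonormal_diagonalization[OF matrix_vector_mul_linear M P]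
    by (elim exE conjE) (rule that)
  have BC: "B \<inter> C = {}"
  proof -
    have False if "x \<in> B" "x \<in> C" for x
    proof -
      have "orthogonal x x" "norm x = 1" using that B(1,3) C(1) by (auto simp: P_def)
      then show False by (simp add: orthogonal_def)
    qed
    then show ?thesis by blast
  qed
  have indep: "independent B" "independent C"
    using pairwise_orthogonal_independent[OF B(2)] pairwise_orthogonal_independent[OF C(2)] B(3) C(3)
    by fastforce+
  have "dim P + dim N = CARD('n)"
    using dim_subspace_orthogonal_to_vectors[OF N subspace_UNIV] by (simp add: P_def)
  moreover have "card B = dim N" "card C = dim P"
    using B(4) C(4) indep by (metis dim_eq_card_independent dim_span)+
  moreover have fin: "finite B" "finite C" using indep independent_imp_finite by blast+
  ultimately have cardBC: "card (B \<union> C) = CARD('n)"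
    using BC by (simp add: card_Un_disjoint)
  have normBC: "norm x = 1" if "x \<in> B \<union> C" for x
    using that B(3) C(3) by blast
  have orthBC: "pairwise orthogonal (B \<union> C)"
  proof (rule pairwiseI)
    fix x y assume "x \<in> B \<union> C" "y \<in> B \<union> C" "x \<noteq> y"
    moreover have "orthogonal x y" if "x \<in> B" "y \<in> C" for x y
      using that B(1) C(1) unfolding P_def by blast
    ultimately show "orthogonal x y"
      using B(2) C(2) by (metis Un_iff orthogonal_commute pairwiseD)
  qed
  have "independent (B \<union> C)"
    using orthBC normBC[of 0] by (intro pairwise_orthogonal_independent) auto
  then have spanBC: "span (B \<union> C) = UNIV"
    using card_ge_dim_independent[of "B \<union> C" UNIV] cardBC by auto
  have "\<exists>b :: 'n \<Rightarrow> real^'n. bij_betw b UNIV (B \<union> C)"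
    using fin cardBC by (intro finite_same_card_bij) simp_all
  then obtain b :: "'n \<Rightarrow> real^'n" where b: "bij_betw b UNIV (B \<union> C)"
    by blast
  then have inj: "inj b" and range: "range b = B \<union> C" by (auto simp: bij_betw_def)
  define J where "J = b -` B"
  have inB: "b i \<in> B" if "i \<in> J" for i using that by (simp add: J_def)
  have inC: "b i \<in> C" if "i \<notin> J" for i using that range by (auto simp: J_def)
  have bJ: "b ` J = B" using range by (auto simp: J_def)
  have ortho: "b i \<bullet> b j = (if i = j then 1 else 0)" for i j
  proof -
    have "b i \<in> B \<union> C" "b j \<in> B \<union> C" using range by auto
    then show ?thesis
      using inj orthBC normBC by (auto simp: pairwise_def orthogonal_def norm_eq_1 inj_eq)
  qed
  have ker: "M *v b j = 0" if "j \<in> J" for j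
    using inB[OF that] B(1) by (auto simp: N_def)
  have offM: "b i \<bullet> (M *v b j) = 0" if "i \<notin> J" "i \<noteq> j" for i j
  proof (cases "j \<in> J")
    case True
    then show ?thesis by (simp add: ker)
  next
    case False
    then have "b i \<in> C" "b j \<in> C" "b i \<noteq> b j" using inC that inj by (auto simp: inj_eq)
    then show ?thesis using C(5) by blast
  qed
  have diagM: "b i \<bullet> (M *v b i) \<noteq> 0" if i: "i \<notin> J" for i
  proof
    assume 0: "b i \<bullet> (M *v b i) = 0"
    have orth: "b j \<bullet> (M *v b i) = 0" for j
    proof (cases "j \<in> J")
      case True
      then show ?thesis using ker[of j] M[of "b j" "b i"] by simp
    next
      case False
      then show ?thesis using 0 offM[of j i] by (cases "j = i") auto
    qed
    have "M *v b i \<in> span (B \<union> C)" using spanBC by simp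
    moreover have "orthogonal (M *v b i) y" if "y \<in> B \<union> C" for y
    proof -
      have "y \<in> range b" using that range by simp
      then obtain j where "y = b j" by blast
      then show ?thesis using orth[of j] by (simp add: orthogonal_def inner_commute)
    qed
    ultimately have "orthogonal (M *v b i) (M *v b i)"
      using orthogonal_to_span by blast
    then have "M *v b i = 0" by (simp add: orthogonal_def)
    then have "b i \<in> N" by (simp add: N_def)
    then have "orthogonal (b i) (b i)" using inC[OF i] C(1) by (auto simp: P_def)
    then show False using ortho[of i i] by (simp add: orthogonal_def)
  qed
  have diagK: "b i \<bullet> (K *v b j) = 0" if "i \<in> J" "j \<in> J" "i \<noteq> j" for i j
  proof -
    have "b i \<in> B" "b j \<in> B" "b i \<noteq> b j" using inB that inj by (auto simp: inj_eq)
    then show ?thesis using B(5) by blast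
  qed
  have "{v. M *v v = 0} = span (b ` J)" using bJ B(4) by (simp add: N_def)
  then have "adapted_basis M K b J"
    unfolding adapted_basis_def using ortho offM diagM diagK by simp
  then show ?thesis by blast
qed

text \<open>
  Rows outside \<open>J\<close> are diagonal, and so is the block with rows and columns in \<open>J\<close>; the matrix is block
  triangular, and a permutation other than the identity picks up a zero entry.
\<close>

lemma det_semidiagonal:
  fixes A :: "'a::comm_ring_1^'n^'n"
  assumes off: "\<And>i j. \<lbrakk>i \<notin> J; i \<noteq> j\<rbrakk> \<Longrightarrow> A $ i $ j = 0"
    and offJ: "\<And>i j. \<lbrakk>i \<in> J; j \<in> J; i \<noteq> j\<rbrakk> \<Longrightarrow> A $ i $ j = 0"
  shows "det A = (\<Prod>i\<in>UNIV. A $ i $ i)"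
proof -
  have "(\<Prod>i\<in>UNIV. A $ i $ p i) = 0" if p: "p permutes UNIV" "p \<noteq> id" for p
  proof -
    obtain i where i: "p i \<noteq> i" using p by (auto simp: fun_eq_iff)
    have "\<exists>i. A $ i $ p i = 0"
    proof (cases "i \<in> J \<and> p i \<in> J")
      case True
      then show ?thesis using i offJ by metis
    next
      case False
      moreover have "p (p i) \<noteq> p i" using i p(1) by (metis permutes_inj injD)
      ultimately show ?thesis using i off by metis
    qed
    then show ?thesis by (meson UNIV_I finite prod_zero)
  qed
  then have "det A = (\<Sum>p\<in>{id}. of_int (sign p) * (\<Prod>i\<in>UNIV. A $ i $ p i))"
    unfolding det_def
    by (intro sum.mono_neutral_right) (auto simp: permutes_id finite_permutations)
  then show ?thesis by simp
qed

section \<open>Sign patterns of products of linear factors\<close>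

lemma coeff_linear_mult: "coeff ([:a, 1:] * p) m = a * coeff p m + (if m = 0 then 0 else coeff p (m - 1))"
  for a :: "'a::comm_ring_1"
  by (cases m) auto

lemma degree_prod_linear:
  fixes \<kappa> :: "'i \<Rightarrow> real"
  shows "degree (\<Prod>i\<in>J. [:\<kappa> i, 1:]) = card J"
  by (subst degree_prod_eq_sum_degree) auto

lemma coeff_prod_linear_pos:
  fixes \<kappa> :: "'i \<Rightarrow> real"
  assumes "finite J" "\<And>i. i \<in> J \<Longrightarrow> \<kappa> i > 0" "m \<le> card J"
  shows "coeff (\<Prod>i\<in>J. [:\<kappa> i, 1:]) m > 0"
  using assms
proof (induction J arbitrary: m rule: finite_induct)
  case empty
  then show ?case by simp
next
  case (insert x F)
  define p where "p = (\<Prod>i\<in>F. [:\<kappa> i, 1:])"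
  have pos: "coeff p n > 0" if "n \<le> card F" for n
    unfolding p_def using insert.IH insert.prems(1) that by simp
  have zero: "coeff p n = 0" if "card F < n" for n
    using that by (simp add: p_def coeff_eq_0 degree_prod_linear)
  have \<kappa>: "\<kappa> x > 0" using insert.prems(1) by simp
  have eq: "coeff (\<Prod>i\<in>insert x F. [:\<kappa> i, 1:]) m = \<kappa> x * coeff p m + (if m = 0 then 0 else coeff p (m - 1))"
    unfolding p_def by (simp only: prod.insert[OF insert.hyps] coeff_linear_mult)
  consider "m = 0" | "m \<noteq> 0" "m \<le> card F" | "m = Suc (card F)"
    using insert.prems(2) insert.hyps by (cases "m \<le> card F") auto
  then show ?case
  proof cases
    case 1
    then show ?thesis unfolding eq using pos[of 0] \<kappa> by simp
  next
    case 2
    then show ?thesis unfolding eq using pos[of m] pos[of "m - 1"] \<kappa> by (simp add: add_pos_pos)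
  next
    case 3
    then show ?thesis unfolding eq using pos[of "card F"] zero[of m] by simp
  qed
qed

lemma coeff_prod_linear_uminus:
  fixes \<kappa> :: "'i \<Rightarrow> real"
  assumes "finite J"
  shows "coeff (\<Prod>i\<in>J. [:- \<kappa> i, 1:]) m = (-1) ^ (card J + m) * coeff (\<Prod>i\<in>J. [:\<kappa> i, 1:]) m"
  using assms
proof (induction J arbitrary: m rule: finite_induct)
  case empty
  then show ?case by (cases m) auto
next
  case (insert x F)
  show ?case
    unfolding prod.insert[OF insert.hyps] coeff_linear_mult insert.IH card_insert_disjoint[OF insert.hyps]
    by (cases m) (simp_all add: algebra_simps)
qed

lemma poly_pos_if_coeffs_pos:
  fixes p :: "real poly"
  assumes "\<And>m. m \<le> degree p \<Longrightarrow> coeff p m > 0" "x \<ge> 0"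
  shows "poly p x > 0"
  unfolding poly_altdef
proof (rule sum_pos2[where i = 0])
  show "0 \<le> coeff p m * x ^ m" if "m \<in> {..degree p}" for m
    using assms(1)[of m] assms(2) that by simp
qed (use assms(1)[of 0] in auto)

text \<open>
  A polynomial whose coefficients are all positive has no root in \<open>[0, \<infinity>)\<close>; conversely a product of
  linear factors \<open>X + \<kappa>\<close> with all \<open>\<kappa> > 0\<close> has positive coefficients. The index \<open>card J - j\<close> lists the
  coefficients from the top down, which is the order used for critical points.
\<close>

lemma all_same_sign_prod_linear:
  fixes \<kappa> :: "'i \<Rightarrow> real"
  assumes J: "finite J" and c: "c \<noteq> 0"
  shows "all_same_sign (card J) (\<lambda>j. coeff (smult c (\<Prod>i\<in>J. [:\<kappa> i, 1:])) (card J - j)) \<longleftrightarrow> (\<forall>i\<in>J. \<kappa> i > 0)"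
    (is "?L \<longleftrightarrow> ?R")
proof
  assume ?R
  then have "coeff (\<Prod>i\<in>J. [:\<kappa> i, 1:]) (card J - j) > 0" for j
    using coeff_prod_linear_pos[OF J] by simp
  then show ?L
    using c unfolding all_same_sign_def coeff_smult
    by (meson linorder_neqE_linordered_idom mult_neg_pos mult_pos_pos)
next
  assume L: ?L
  define q where "q = smult c (\<Prod>i\<in>J. [:\<kappa> i, 1:])"
  have deg: "degree q = card J" using c by (simp add: q_def degree_prod_linear)
  have flip: "\<exists>j\<le>card J. m = card J - j" if "m \<le> degree q" for m
    using that deg by (intro exI[of _ "card J - m"]) simp
  consider "\<forall>m\<le>degree q. coeff q m > 0" | "\<forall>m\<le>degree (-q). coeff (-q) m > 0"
    using L flip unfolding all_same_sign_def q_def[symmetric] by auto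
  then have nz: "poly q x \<noteq> 0" if "x \<ge> 0" for x
    using poly_pos_if_coeffs_pos[OF _ that, of q] poly_pos_if_coeffs_pos[OF _ that, of "-q"] by cases auto
  show ?R
  proof
    fix i assume i: "i \<in> J"
    then have "poly q (- \<kappa> i) = 0" using J by (auto simp: q_def poly_prod)
    then show "\<kappa> i > 0" using nz[of "- \<kappa> i"] by linarith
  qed
qed

lemma all_same_sign_iff_sgn:
  "all_same_sign k s \<longleftrightarrow> (\<forall>j\<le>k. s j \<noteq> 0) \<and> (\<forall>j<k. sgn (s (Suc j)) = sgn (s j))" (is "?L \<longleftrightarrow> ?R")
proof
  assume ?L
  then show ?R by (auto simp: all_same_sign_def)
next
  assume R: ?R
  have "sgn (s j) = sgn (s 0)" if "j \<le> k" for j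
    using that R by (induction j) auto
  then have sgn: "\<forall>j\<le>k. sgn (s j) = sgn (s 0)" by blast
  have "s 0 \<noteq> 0" using R by blast
  then consider "s 0 > 0" | "s 0 < 0" by linarith
  then show ?L
  proof cases
    case 1
    then have "\<forall>j\<le>k. s j > 0" using sgn by (simp add: sgn_1_pos)
    then show ?thesis by (simp add: all_same_sign_def)
  next
    case 2
    then have "\<forall>j\<le>k. s j < 0" using sgn by (simp add: sgn_1_neg)
    then show ?thesis by (simp add: all_same_sign_def)
  qed
qed

lemma all_same_sign_cong:
  "(\<And>j. j \<le> k \<Longrightarrow> a j = b j) \<Longrightarrow> all_same_sign k a = all_same_sign k b"
  by (simp add: all_same_sign_def)

lemma strictly_alternating_iff_all_same_sign:
  "strictly_alternating k a \<longleftrightarrow> all_same_sign k (\<lambda>j. (-1) ^ j * a j)"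
proof -
  have "sgn ((-1) ^ Suc j * a (Suc j)) = sgn ((-1) ^ j * a j) \<longleftrightarrow> sgn (a (Suc j)) = - sgn (a j)" for j
    by (cases "even j") auto
  then show ?thesis by (simp add: all_same_sign_iff_sgn strictly_alternating_def)
qed

text \<open>
  The substitution \<open>X \<mapsto> - X\<close> turns alternation into constancy of sign and replaces each \<open>\<kappa>\<close> by \<open>- \<kappa>\<close>.
\<close>

lemma strictly_alternating_prod_linear:
  fixes \<kappa> :: "'i \<Rightarrow> real"
  assumes J: "finite J" and c: "c \<noteq> 0"
  shows "strictly_alternating (card J) (\<lambda>j. coeff (smult c (\<Prod>i\<in>J. [:\<kappa> i, 1:])) (card J - j)) \<longleftrightarrow> (\<forall>i\<in>J. \<kappa> i < 0)"
proof -
  have "(-1) ^ j * coeff (smult c (\<Prod>i\<in>J. [:\<kappa> i, 1:])) (card J - j) =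
        coeff (smult c (\<Prod>i\<in>J. [:- \<kappa> i, 1:])) (card J - j)" if "j \<le> card J" for j
  proof -
    have "even (card J + (card J - j)) \<longleftrightarrow> even j" using that by auto
    then have "(-1::real) ^ (card J + (card J - j)) = (-1) ^ j" by (simp add: uminus_power_if)
    then show ?thesis using J by (simp add: coeff_prod_linear_uminus)
  qed
  then have "strictly_alternating (card J) (\<lambda>j. coeff (smult c (\<Prod>i\<in>J. [:\<kappa> i, 1:])) (card J - j)) \<longleftrightarrow>
      all_same_sign (card J) (\<lambda>j. coeff (smult c (\<Prod>i\<in>J. [:- \<kappa> i, 1:])) (card J - j))"
    unfolding strictly_alternating_iff_all_same_sign by (intro all_same_sign_cong)
  then show ?thesis using all_same_sign_prod_linear[OF J c, of "\<lambda>i. - \<kappa> i"] by simp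
qed

section \<open>The lowest homogeneous part of the determinant\<close>

text \<open>
  Restricting \<open>p\<close> to the line \<open>t \<mapsto> (x t, t)\<close> through the origin turns the homogeneous part \<open>P\<^sub>k\<close> into
  the coefficient of \<open>t\<^sup>k\<close>: it is \<open>P\<^sub>k(x, 1)\<close>. In \<open>poly p [:0, x:]\<close> the first variable of \<open>p\<close> is
  replaced by \<open>x\<close> times the second one, so this is that restriction.
\<close>

lemma coeff_substitute_multiple:
  "coeff (poly p [:0, x:]) k = poly (\<Sum>m\<le>k. monom (coeff2 p m (k - m)) m) x"
proof -
  have "poly p [:0, x:] = (\<Sum>m\<le>degree p. monom (x ^ m) m * coeff p m)"
  proof -
    have "[:0, x:] ^ m = monom (x ^ m) m" for m
      by (induction m) (simp_all add: monom_Suc monom_0 mult_monom smult_monom)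
    then show ?thesis by (simp add: poly_altdef mult.commute)
  qed
  then have "coeff (poly p [:0, x:]) k = (\<Sum>m\<le>degree p. if k < m then 0 else x ^ m * coeff2 p m (k - m))"
    unfolding coeff2_def by (simp add: coeff_sum coeff_monom_mult)
  also have "\<dots> = (\<Sum>m\<le>k. coeff2 p m (k - m) * x ^ m)"
    by (rule sum.mono_neutral_cong) (auto simp: coeff2_def coeff_eq_0 mult.commute)
  finally show ?thesis by (simp add: poly_sum poly_monom)
qed

lemma poly_substitute_multiple:
  fixes p :: "real poly poly"
  shows "poly (poly p [:0, x:]) t = poly (poly p [:x * t:]) t"
  by (simp add: poly_altdef[of p] poly_sum poly_power mult.commute)

text \<open>
  Dehomogenising loses nothing: \<open>P\<^sub>k\<close> and \<open>P\<^sub>k(x, 1)\<close> have the same coefficients, so they vanish together.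
\<close>

lemma lowest_degree_eqI:
  assumes "\<And>k. k < d \<Longrightarrow> (\<Sum>m\<le>k. monom (coeff2 p m (k - m)) m) = 0"
    and "(\<Sum>m\<le>d. monom (coeff2 p m (d - m)) m) \<noteq> 0"
  shows "lowest_degree p = d"
proof -
  have coeff_hom_part: "coeff (hom_part k p) m = monom (coeff (\<Sum>m\<le>k. monom (coeff2 p m (k - m)) m) m) (k - m)" for k m
    by (simp add: hom_part_def coeff_sum coeff_monom if_distrib[of "\<lambda>a. monom a _"] cong: if_cong)
  have "hom_part k p = 0 \<longleftrightarrow> (\<Sum>m\<le>k. monom (coeff2 p m (k - m)) m) = 0" for k
    by (auto simp: poly_eq_iff[of "hom_part k p"] coeff_hom_part poly_eq_iff[of "\<Sum>m\<le>k. _ m"] monom_eq_0_iff)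
  then show ?thesis
    unfolding lowest_degree_def using assms by (intro Least_equality) (auto simp: not_less[symmetric])
qed

lemma det_change_of_basis:
  fixes X :: "real^'n^'n" and b :: "'n \<Rightarrow> real^'n"
  assumes ortho: "\<And>i j. b i \<bullet> b j = (if i = j then 1 else 0)"
  shows "det X = det (\<chi> i j. b i \<bullet> (X *v b j))"
proof -
  define B :: "real^'n^'n" where "B = (\<chi> i j. b j $ i)"
  have col: "column j B = b j" for j by (simp add: B_def column_def vec_eq_iff)
  have BB: "transpose B ** B = mat 1"
    by (simp add: matrix_mult_transpose_dot_column col ortho mat_def)
  have "transpose B ** (X ** B) = (\<chi> i j. b i \<bullet> (X *v b j))"
    by (simp add: vec_eq_iff matrix_matrix_mult_def matrix_vector_mult_def inner_vec_def B_def transpose_def)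
  then have "det (\<chi> i j. b i \<bullet> (X *v b j)) = det (transpose B) * (det X * det B)"
    by (metis det_mul)
  also have "\<dots> = det X * det (transpose B ** B)" by (simp add: det_mul)
  finally show ?thesis by (simp add: BB)
qed

text \<open>
  In an adapted basis each of the \<open>d = card J\<close> kernel rows of \<open>M - x t I - t K\<close> is divisible by \<open>t\<close>.
  Once these factors are removed, the matrix at \<open>t = 0\<close> is semidiagonal, so that
  \<open>det (M - x t I - t K) = t\<^sup>d (c \<Prod>(x + \<kappa>\<^sub>i) + O(t))\<close>. Here the \<open>\<kappa>\<^sub>i\<close> are the eigenvalues of the compression
  of \<open>K\<close> to the kernel of \<open>M\<close>, and \<open>c\<close> is, up to sign, the product of the nonzero eigenvalues of \<open>M\<close>.
\<close>

lemma lowest_part_det_poly: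
  fixes M :: operator2 and b :: "idx2 \<Rightarrow> form2"
  assumes sym: "\<And>x y. (M *v x) \<bullet> y = x \<bullet> (M *v y)" and adapted: "adapted_basis M hodge b J"
  shows "\<exists>c. c \<noteq> 0 \<and> (\<forall>k<card J. (\<Sum>m\<le>k. monom (coeff2 (det_poly M) m (k - m)) m) = 0) \<and>
    (\<Sum>m\<le>card J. monom (coeff2 (det_poly M) m (card J - m)) m)
      = smult c (\<Prod>i\<in>J. [:b i \<bullet> (hodge *v b i), 1:])"
proof -
  note ortho = adapted_basisD(1)[OF adapted] and diagK = adapted_basisD(3)[OF adapted]
    and nz = adapted_basisD(4)[OF adapted] and diagM = adapted_basisD(5)[OF adapted]
    and ker = adapted_basis_kernel[OF adapted]
  define \<mu> where "\<mu> i = b i \<bullet> (M *v b i)" for i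
  define h where "h i j = b i \<bullet> (hodge *v b j)" for i j
  \<comment> \<open>The matrix of \<open>M - x t I - t K\<close> in the basis \<open>b\<close>, with the factor \<open>t\<close> taken out of the rows in \<open>J\<close>;
    its entries are polynomials in \<open>t\<close>.\<close>
  define G :: "real \<Rightarrow> real poly^idx2^idx2" where
    "G x = (\<chi> i j. if i \<in> J then [:- (x * (if i = j then 1 else 0) + h i j):]
                   else [:b i \<bullet> (M *v b j), - (x * (if i = j then 1 else 0) + h i j):])" for x
  define c where "c = (- 1) ^ card J * (\<Prod>i\<in>-J. \<mu> i)"
  have split: "(\<Prod>i\<in>UNIV. f i) = (\<Prod>i\<in>J. f i) * (\<Prod>i\<in>-J. f i)" for f :: "idx2 \<Rightarrow> real"
    using prod.union_disjoint[of J "-J" f] by (simp add: Compl_partition)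
  have G0: "poly (det (G x)) 0 = poly (smult c (\<Prod>i\<in>J. [:h i i, 1:])) x" for x
  proof -
    have "poly (det (G x)) 0 = (\<Prod>i\<in>UNIV. (\<chi> i j. poly (G x $ i $ j) 0) $ i $ i)"
      unfolding poly_det
      by (rule det_semidiagonal[where J = J]) (auto simp: G_def h_def diagK diagM)
    also have "\<dots> = (\<Prod>i\<in>J. - (h i i + x)) * (\<Prod>i\<in>-J. \<mu> i)"
      unfolding split by (intro arg_cong2[where f = times] prod.cong) (auto simp: G_def \<mu>_def)
    also have "(\<Prod>i\<in>J. - (h i i + x)) = (- 1) ^ card J * (\<Prod>i\<in>J. h i i + x)"
      by (subst mult_minus1[symmetric]) (simp only: prod.distrib prod_constant)
    finally show ?thesis by (simp add: c_def poly_prod)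
  qed
  have det: "poly (poly (det_poly M) [:0, x:]) t = t ^ card J * poly (det (G x)) t" for x t
  proof -
    have "poly (poly (det_poly M) [:0, x:]) t = det (M - (x * t) *\<^sub>R mat 1 - t *\<^sub>R hodge)"
      by (simp add: poly_substitute_multiple poly_det_poly)
    also have "\<dots> = det (\<chi> i j. b i \<bullet> ((M - (x * t) *\<^sub>R mat 1 - t *\<^sub>R hodge) *v b j))"
      by (rule det_change_of_basis[OF ortho])
    also have "(\<chi> i j. b i \<bullet> ((M - (x * t) *\<^sub>R mat 1 - t *\<^sub>R hodge) *v b j))
        = (\<chi> i. (if i \<in> J then t else 1) *s (\<chi> j. poly (G x $ i $ j) t))"
    proof -
      have "b i \<bullet> ((M - (x * t) *\<^sub>R mat 1 - t *\<^sub>R hodge) *v b j)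
          = b i \<bullet> (M *v b j) - t * (x * (if i = j then 1 else 0) + h i j)" for i j
        by (simp add: matrix_vector_mult_diff_rdistrib scaleR_matrix_vector_assoc[symmetric]
            inner_diff_right ortho h_def algebra_simps)
      moreover have "b i \<bullet> (M *v b j) = 0" if "i \<in> J" for i j
        using sym[of "b i" "b j"] ker[OF that] by simp
      ultimately show ?thesis
        by (simp add: vec_eq_iff G_def algebra_simps)
    qed
    also have "det \<dots> = (\<Prod>i\<in>UNIV. if i \<in> J then t else 1) * det (\<chi> i j. poly (G x $ i $ j) t)"
      by (rule det_rows_mul)
    also have "\<dots> = t ^ card J * poly (det (G x)) t"
      by (simp add: split poly_det)
    finally show ?thesis .
  qed
  have factor: "poly (det_poly M) [:0, x:] = monom 1 (card J) * det (G x)" for x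
    unfolding poly_eq_poly_eq_iff[symmetric] fun_eq_iff by (simp add: det poly_monom)
  show ?thesis
  proof (intro exI[of _ c] conjI allI impI)
    show "c \<noteq> 0" using nz by (simp add: c_def \<mu>_def)
    show "(\<Sum>m\<le>k. monom (coeff2 (det_poly M) m (k - m)) m) = 0" if "k < card J" for k
      unfolding poly_eq_poly_eq_iff[symmetric] fun_eq_iff coeff_substitute_multiple[symmetric] factor
      using that by (simp add: coeff_monom_mult)
    show "(\<Sum>m\<le>card J. monom (coeff2 (det_poly M) m (card J - m)) m) = smult c (\<Prod>i\<in>J. [:b i \<bullet> (hodge *v b i), 1:])"
      unfolding poly_eq_poly_eq_iff[symmetric] fun_eq_iff coeff_substitute_multiple[symmetric] factor
      using G0 by (simp add: coeff_monom_mult h_def poly_0_coeff_0[symmetric] del: poly_smult)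
  qed
qed

section \<open>Critical points as Lagrange points\<close>

text \<open>
  A diagonal quadratic form is anisotropic iff it is definite: two diagonal entries of opposite sign
  combine, with the square roots of their absolute values exchanged, to an isotropic vector. For
  \<open>J = {}\<close> both sides fail.
\<close>

lemma null_vector_iff:
  fixes b :: "'n::finite \<Rightarrow> real^'n"
  assumes ortho: "\<And>i j. b i \<bullet> b j = (if i = j then 1 else 0)"
    and diag: "\<And>i j. \<lbrakk>i \<in> J; j \<in> J; i \<noteq> j\<rbrakk> \<Longrightarrow> b i \<bullet> (K *v b j) = 0"
  shows "(\<exists>v\<in>span (b ` J). v \<noteq> 0 \<and> v \<bullet> (K *v v) = 0) \<longleftrightarrow>
    \<not> (\<forall>i\<in>J. b i \<bullet> (K *v b i) > 0) \<and> \<not> (\<forall>i\<in>J. b i \<bullet> (K *v b i) < 0)" (is "?L \<longleftrightarrow> ?R")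
proof -
  define \<kappa> where "\<kappa> i = b i \<bullet> (K *v b i)" for i
  define lc where "lc a = (\<Sum>i\<in>J. a i *\<^sub>R b i)" for a
  have K_lc: "lc a \<bullet> (K *v lc a) = (\<Sum>i\<in>J. \<kappa> i * (a i)\<^sup>2)" for a
  proof -
    have "lc a \<bullet> (K *v lc a) = (\<Sum>i\<in>J. \<Sum>j\<in>J. a i * a j * (b i \<bullet> (K *v b j)))"
      by (simp add: lc_def linear_sum[OF matrix_vector_mul_linear] inner_sum_left inner_sum_right matrix_vector_mult_scaleR sum_distrib_left mult_ac)
        (subst sum.swap, simp add: mult_ac)
    also have "\<dots> = (\<Sum>i\<in>J. \<Sum>j\<in>J. if i = j then \<kappa> i * (a i)\<^sup>2 else 0)"
      by (intro sum.cong) (auto simp: diag \<kappa>_def power2_eq_square)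
    finally show ?thesis by simp
  qed
  have inner_lc: "lc a \<bullet> b i = (if i \<in> J then a i else 0)" for a i
    by (simp add: lc_def inner_sum_left ortho if_distrib cong: if_cong)
  have span: "v \<in> span (b ` J) \<longleftrightarrow> (\<exists>a. v = lc a)" for v
  proof -
    have inj: "inj_on b J" using ortho by (metis inj_onI zero_neq_one)
    show ?thesis
    proof
      assume "v \<in> span (b ` J)"
      then obtain u where "v = (\<Sum>x\<in>b ` J. u x *\<^sub>R x)" by (auto simp: span_finite)
      then have "v = lc (u \<circ> b)" by (simp add: lc_def sum.reindex[OF inj])
      then show "\<exists>a. v = lc a" by blast
    next
      assume "\<exists>a. v = lc a"
      then show "v \<in> span (b ` J)"
        by (auto simp: lc_def intro: span_sum span_scale span_base)
    qed
  qed
  show ?thesis unfolding \<kappa>_def[symmetric]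
  proof
    assume ?L
    then obtain a where a: "lc a \<noteq> 0" "(\<Sum>i\<in>J. \<kappa> i * (a i)\<^sup>2) = 0" by (auto simp: span K_lc)
    obtain i where i: "i \<in> J" "a i \<noteq> 0"
    proof (rule ccontr)
      assume "\<not> thesis"
      then have "\<forall>i\<in>J. a i = 0" using that by blast
      then show False using a(1) by (simp add: lc_def)
    qed
    have "\<not> (\<forall>i\<in>J. \<kappa> i > 0)"
    proof
      assume pos: "\<forall>i\<in>J. \<kappa> i > 0"
      have "(\<Sum>i\<in>J. \<kappa> i * (a i)\<^sup>2) > 0"
        by (rule sum_pos2[where i = i]) (use pos i in \<open>auto simp: less_imp_le\<close>)
      then show False using a(2) by simp
    qed
    moreover have "\<not> (\<forall>i\<in>J. \<kappa> i < 0)"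
    proof
      assume neg: "\<forall>i\<in>J. \<kappa> i < 0"
      have "(\<Sum>i\<in>J. - \<kappa> i * (a i)\<^sup>2) > 0"
        by (rule sum_pos2[where i = i]) (use neg i in \<open>auto simp: less_imp_le mult_nonpos_nonneg mult_neg_pos\<close>)
      then show False using a(2) by (simp add: sum_negf)
    qed
    ultimately show "\<not> (\<forall>i\<in>J. \<kappa> i > 0) \<and> \<not> (\<forall>i\<in>J. \<kappa> i < 0)" by blast
  next
    assume "\<not> (\<forall>i\<in>J. \<kappa> i > 0) \<and> \<not> (\<forall>i\<in>J. \<kappa> i < 0)"
    then obtain i j where i: "i \<in> J" "\<kappa> i \<le> 0" and j: "j \<in> J" "\<kappa> j \<ge> 0" by (meson not_le)
    have "\<exists>a. (\<exists>l\<in>J. a l \<noteq> 0) \<and> (\<Sum>i\<in>J. \<kappa> i * (a i)\<^sup>2) = 0"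
    proof (cases "\<kappa> i = 0")
      case True
      then show ?thesis using i
        by (intro exI[of _ "\<lambda>l. if l = i then 1 else 0"]) (auto intro!: sum.neutral)
    next
      case False
      then have neg: "\<kappa> i < 0" "i \<noteq> j" using i j by auto
      define a where "a l = (if l = i then sqrt (\<kappa> j) else if l = j then sqrt (- \<kappa> i) else 0)" for l
      have "(\<Sum>l\<in>J. \<kappa> l * (a l)\<^sup>2) = (\<Sum>l\<in>{i, j}. \<kappa> l * (a l)\<^sup>2)"
        by (rule sum.mono_neutral_right) (use i j in \<open>auto simp: a_def\<close>)
      also have "\<dots> = 0" using neg j by (simp add: a_def)
      finally show ?thesis using j neg by (intro exI[of _ a] conjI bexI[of _ j]) (auto simp: a_def)
    qed
    then obtain a l where a: "l \<in> J" "a l \<noteq> 0" "(\<Sum>i\<in>J. \<kappa> i * (a i)\<^sup>2) = 0" by blast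
    have "lc a \<noteq> 0" using inner_lc[of a l] a(1,2) by auto
    moreover have "lc a \<in> span (b ` J)" using span by blast
    moreover have "lc a \<bullet> (K *v lc a) = 0" using a(3) by (simp add: K_lc)
    ultimately show ?L by blast
  qed
qed

text \<open>
  Put \<open>M = R - x\<^sub>1 I - y\<^sub>1 K\<close>. The lowest homogeneous part of \<open>det (M - x I - y K)\<close> has constant
  or alternating signs exactly when \<open>K\<close> is definite on the kernel of \<open>M\<close>. So \<open>(x\<^sub>1, y\<^sub>1)\<close> is critical iff
  that kernel contains a unit vector \<open>v\<close> with \<open>\<langle>v, K v\<rangle> = 0\<close>, i.e. an element of \<open>S2\<close>. The equation
  \<open>R v = x\<^sub>1 v + y\<^sub>1 K v\<close> is the Lagrange condition for \<open>\<langle>v, R v\<rangle>\<close> under the constraints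
  \<open>\<langle>v, v\<rangle> = 1\<close> and \<open>\<langle>v, K v\<rangle> = 0\<close>.
\<close>

lemma critical_point_iff:
  fixes R :: operator2
  assumes sym: "\<And>v w. (R *v v) \<bullet> w = v \<bullet> (R *v w)"
  shows "critical_point R x1 y1 \<longleftrightarrow> (\<exists>v\<in>S2. R *v v = x1 *\<^sub>R v + y1 *\<^sub>R (hodge *v v))"
proof -
  define M where "M = R - x1 *\<^sub>R mat 1 - y1 *\<^sub>R hodge"
  have M: "M *v v = R *v v - x1 *\<^sub>R v - y1 *\<^sub>R (hodge *v v)" for v
    by (simp add: M_def matrix_vector_mult_diff_rdistrib scaleR_matrix_vector_assoc[symmetric])
  have M_eq_0: "M *v v = 0 \<longleftrightarrow> R *v v = x1 *\<^sub>R v + y1 *\<^sub>R (hodge *v v)" for v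
    unfolding M diff_diff_add right_minus_eq ..
  have symM: "(M *v v) \<bullet> w = v \<bullet> (M *v w)" for v w
    by (simp add: M inner_diff_left inner_diff_right sym hodge_symmetric)
  obtain b J where b: "adapted_basis M hodge b J"
    using adapted_basis_exists[OF symM hodge_symmetric] by blast
  define q where "q = (\<Prod>i\<in>J. [:b i \<bullet> (hodge *v b i), 1:])"
  have "\<exists>c. c \<noteq> 0 \<and> (\<forall>k<card J. (\<Sum>m\<le>k. monom (coeff2 (det_poly M) m (k - m)) m) = 0) \<and>
    (\<Sum>m\<le>card J. monom (coeff2 (det_poly M) m (card J - m)) m) = smult c q"
    unfolding q_def by (rule lowest_part_det_poly[OF symM b])
  then obtain c where c: "c \<noteq> 0"
    "\<forall>k<card J. (\<Sum>m\<le>k. monom (coeff2 (det_poly M) m (k - m)) m) = 0"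
    "(\<Sum>m\<le>card J. monom (coeff2 (det_poly M) m (card J - m)) m) = smult c q"
    by (elim exE conjE) (rule that)
  have "q \<noteq> 0" by (simp add: q_def)
  then have deg: "lowest_degree (det_poly M) = card J"
    using c by (intro lowest_degree_eqI) auto
  have coeff: "coeff2 (det_poly M) (card J - j) j = coeff (smult c q) (card J - j)" if "j \<le> card J" for j
    using that by (simp add: c(3)[symmetric] coeff_sum)
  have "critical_point R x1 y1 \<longleftrightarrow> \<not> all_same_sign (card J) (\<lambda>j. coeff (smult c q) (card J - j))
      \<and> \<not> strictly_alternating (card J) (\<lambda>j. coeff (smult c q) (card J - j))"
    unfolding critical_point_def Let_def M_def[symmetric] deg strictly_alternating_iff_all_same_sign
    using coeff by (simp cong: all_same_sign_cong)
  also have "\<dots> \<longleftrightarrow> (\<exists>v\<in>span (b ` J). v \<noteq> 0 \<and> v \<bullet> (hodge *v v) = 0)"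
    unfolding q_def all_same_sign_prod_linear[OF finite c(1)] strictly_alternating_prod_linear[OF finite c(1)]
    using null_vector_iff[where K = hodge, OF adapted_basisD(1,3)[OF b]] by simp
  also have "\<dots> \<longleftrightarrow> (\<exists>v. M *v v = 0 \<and> v \<noteq> 0 \<and> v \<bullet> (hodge *v v) = 0)"
    unfolding adapted_basisD(2)[OF b, symmetric] by simp
  also have "\<dots> \<longleftrightarrow> (\<exists>v\<in>S2. M *v v = 0)"
  proof
    assume "\<exists>v. M *v v = 0 \<and> v \<noteq> 0 \<and> v \<bullet> (hodge *v v) = 0"
    then obtain v where v: "M *v v = 0" "v \<noteq> 0" "v \<bullet> (hodge *v v) = 0" by blast
    have "v /\<^sub>R norm v \<in> S2" "M *v (v /\<^sub>R norm v) = 0"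
      using v by (simp_all add: S2_def decomposable_iff matrix_vector_mult_scaleR norm_eq_1[symmetric])
    then show "\<exists>v\<in>S2. M *v v = 0" by blast
  next
    assume "\<exists>v\<in>S2. M *v v = 0"
    then show "\<exists>v. M *v v = 0 \<and> v \<noteq> 0 \<and> v \<bullet> (hodge *v v) = 0"
      by (auto simp: S2_def decomposable_iff)
  qed
  finally show ?thesis unfolding M_eq_0 .
qed

section \<open>Minimising the sectional curvature\<close>

text \<open>
  The Lagrange condition at a minimum. Given \<open>w\<close> orthogonal to \<open>v\<close> and \<open>K v\<close>, the curve
  \<open>v + t w - (t\<^sup>2/2) \<langle>w, K w\<rangle> K v\<close> stays in the cone \<open>\<langle>u, K u\<rangle> = 0\<close> exactly, because
  \<open>K\<^sup>2 = I\<close>. Minimality makes \<open>\<langle>w, R v\<rangle>\<close> vanish; this is applied to \<open>w\<close>, the component of \<open>R v\<close>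
  orthogonal to \<open>v\<close> and \<open>K v\<close>.
\<close>

lemma minimiser_on_S2:
  fixes R :: operator2
  assumes sym: "\<And>v w. (R *v v) \<bullet> w = v \<bullet> (R *v w)" and v: "v \<in> S2"
    and min: "\<And>u. u \<in> S2 \<Longrightarrow> v \<bullet> (R *v v) \<le> u \<bullet> (R *v u)"
  shows "R *v v = (v \<bullet> (R *v v)) *\<^sub>R v + ((hodge *v v) \<bullet> (R *v v)) *\<^sub>R (hodge *v v)"
proof -
  define m where "m = v \<bullet> (R *v v)"
  define Kv where "Kv = hodge *v v"
  define y where "y = Kv \<bullet> (R *v v)"
  have vv: "v \<bullet> v = 1" and vKv: "v \<bullet> Kv = 0" using v by (auto simp: S2_def decomposable_iff Kv_def)
  have KK: "hodge *v Kv = v" by (simp add: Kv_def hodge_hodge)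
  have Kvv: "Kv \<bullet> Kv = 1" using hodge_symmetric[of v Kv] KK vv by (simp add: Kv_def)
  \<comment> \<open>By homogeneity the bound extends from \<open>S2\<close> to the cone over it.\<close>
  have cone: "m * (u \<bullet> u) \<le> u \<bullet> (R *v u)" if "u \<bullet> (hodge *v u) = 0" for u
  proof (cases "u = 0")
    case False
    then have "u /\<^sub>R norm u \<in> S2"
      using that by (simp add: S2_def decomposable_iff matrix_vector_mult_scaleR norm_eq_1[symmetric])
    from min[OF this] have "m \<le> (u \<bullet> (R *v u)) / (u \<bullet> u)"
      by (simp add: m_def matrix_vector_mult_scaleR power2_norm_eq_inner[symmetric] power2_eq_square divide_simps)
    then show ?thesis using False by (simp add: field_simps)
  qed simp
  define w where "w = R *v v - m *\<^sub>R v - y *\<^sub>R Kv"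
  have wv: "w \<bullet> v = 0" "v \<bullet> w = 0"
    using vv vKv by (simp_all add: w_def m_def inner_diff_left inner_diff_right inner_commute)
  have wK: "w \<bullet> Kv = 0" "Kv \<bullet> w = 0"
    using Kvv vKv by (simp_all add: w_def y_def inner_diff_left inner_diff_right inner_commute)
  define g where "g = w \<bullet> (hodge *v w)"
  define s where "s = - g / 2"
  have vKw: "v \<bullet> (hodge *v w) = 0" using hodge_symmetric[of v w] wK by (simp add: Kv_def)
  have KvKw: "Kv \<bullet> (hodge *v w) = 0" using hodge_symmetric[of Kv w] KK wv by simp
  have Rsym: "w \<bullet> (R *v v) = v \<bullet> (R *v w)" "Kv \<bullet> (R *v v) = v \<bullet> (R *v Kv)" "Kv \<bullet> (R *v w) = w \<bullet> (R *v Kv)"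
    using sym by (metis inner_commute)+
  have "0 \<le> (2 * (v \<bullet> (R *v w))) * t
        + (w \<bullet> (R *v w) - m * (w \<bullet> w) + 2 * s * (v \<bullet> (R *v Kv))) * t^2
        + (2 * s * (w \<bullet> (R *v Kv))) * t^3 + (s^2 * (Kv \<bullet> (R *v Kv) - m)) * t^4" for t
  proof -
    define u where "u = v + t *\<^sub>R w + (s * t^2) *\<^sub>R Kv"
    have Ku: "hodge *v u = Kv + t *\<^sub>R (hodge *v w) + (s * t^2) *\<^sub>R v"
      by (simp add: u_def matrix_vector_right_distrib matrix_vector_mult_scaleR KK Kv_def[symmetric])
    have "u \<bullet> (hodge *v u) = 2 * (s * t^2) + t^2 * g"
      unfolding Ku unfolding u_def
      by (simp add: inner_add_left inner_add_right vv vKv Kvv wv wK vKw KvKw inner_commute[of Kv v] g_def[symmetric] power2_eq_square algebra_simps)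
    then have "u \<bullet> (hodge *v u) = 0" by (simp add: s_def)
    from cone[OF this] have "0 \<le> u \<bullet> (R *v u) - m * (u \<bullet> u)" by simp
    also have "u \<bullet> u = 1 + t^2 * (w \<bullet> w) + (s * t^2)^2"
      unfolding u_def
      by (simp add: inner_add_left inner_add_right vv vKv Kvv wv wK inner_commute[of Kv v] power2_eq_square algebra_simps)
    also have "R *v u = R *v v + t *\<^sub>R (R *v w) + (s * t^2) *\<^sub>R (R *v Kv)"
      by (simp add: u_def matrix_vector_right_distrib matrix_vector_mult_scaleR)
    finally show ?thesis
      unfolding u_def
      by (simp add: inner_add_left inner_add_right Rsym m_def[symmetric] power2_eq_square power3_eq_cube power4_eq_xxxx algebra_simps)
  qed
  then have "2 * (v \<bullet> (R *v w)) = 0" by (rule quartic_min_at_zero)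
  then have "w \<bullet> (R *v v) = 0" using Rsym by simp
  moreover have "R *v v = w + m *\<^sub>R v + y *\<^sub>R Kv" by (simp add: w_def)
  ultimately have "w \<bullet> w = 0" by (simp add: inner_add_right wv wK)
  then have "w = 0" by simp
  then show ?thesis by (simp add: w_def m_def y_def Kv_def algebra_simps)
qed

lemma compact_S2: "compact S2"
proof -
  have "S2 = sphere 0 1 \<inter> {v. v \<bullet> (hodge *v v) = 0}"
    by (auto simp: S2_def decomposable_iff norm_eq_1)
  moreover have "closed {v. v \<bullet> (hodge *v v) = 0}"
    by (intro closed_Collect_eq continuous_intros linear_continuous_on) auto
  ultimately show ?thesis by (metis compact_Int_closed compact_sphere)
qed

lemma exists_critical_minimum:
  fixes R :: operator2
  assumes sym: "\<And>v w. (R *v v) \<bullet> w = v \<bullet> (R *v w)" and "u \<in> S2"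
  obtains x1 y1 where "critical_point R x1 y1" "x1 \<le> u \<bullet> (R *v u)"
proof -
  have "continuous_on S2 (\<lambda>v. v \<bullet> (R *v v))"
    by (intro continuous_intros linear_continuous_on) auto
  then have "\<exists>v\<in>S2. \<forall>u\<in>S2. v \<bullet> (R *v v) \<le> u \<bullet> (R *v u)"
    using compact_S2 assms(2) by (intro continuous_attains_inf) auto
  then obtain v where v: "v \<in> S2" and min: "\<And>u. u \<in> S2 \<Longrightarrow> v \<bullet> (R *v v) \<le> u \<bullet> (R *v u)"
    by blast
  have "critical_point R (v \<bullet> (R *v v)) ((hodge *v v) \<bullet> (R *v v))"
    unfolding critical_point_iff[OF sym] using minimiser_on_S2[OF sym v min] v by blast
  then show ?thesis using min[OF assms(2)] by (rule that)
qed

lemma critical_value: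
  fixes R :: operator2
  assumes sym: "\<And>v w. (R *v v) \<bullet> w = v \<bullet> (R *v w)" and "critical_point R x1 y1"
  obtains v where "v \<in> S2" "v \<bullet> (R *v v) = x1"
proof -
  obtain v where v: "v \<in> S2" "R *v v = x1 *\<^sub>R v + y1 *\<^sub>R (hodge *v v)"
    using assms(2) unfolding critical_point_iff[OF sym] by blast
  then have "v \<bullet> (R *v v) = x1"
    by (simp add: inner_add_right S2_def decomposable_iff)
  with v that show ?thesis by blast
qed

theorem theorem3p5:
  fixes R :: operator2
  assumes "curvature_operator R"
  shows "(sectionally_positive R \<longleftrightarrow> (\<forall>x1 y1. critical_point R x1 y1 \<longrightarrow> x1 > 0)) \<and>
         (sectionally_nonnegative R \<longleftrightarrow> (\<forall>x1 y1. critical_point R x1 y1 \<longrightarrow> x1 \<ge> 0))"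
proof -
  have sym: "(R *v v) \<bullet> w = v \<bullet> (R *v w)" for v w
    using curvature_operator_symmetric[OF assms, of v w] by simp
  have attained: "\<exists>u\<in>S2. u \<bullet> (R *v u) = x1" if "critical_point R x1 y1" for x1 y1
    using critical_value[OF sym that] by blast
  have minimum: "\<exists>x1 y1. critical_point R x1 y1 \<and> x1 \<le> u \<bullet> (R *v u)" if "u \<in> S2" for u
    using exists_critical_minimum[OF sym that] by blast
  \<comment> \<open>Both parts follow for any property of the curvature that is preserved under increase.\<close>
  have "(\<forall>v\<in>S2. P (v \<bullet> (R *v v))) \<longleftrightarrow> (\<forall>x1 y1. critical_point R x1 y1 \<longrightarrow> P x1)"
    if mono: "\<And>s t :: real. P s \<Longrightarrow> s \<le> t \<Longrightarrow> P t" for P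
  proof (intro iffI ballI allI impI)
    fix x1 y1 assume "\<forall>v\<in>S2. P (v \<bullet> (R *v v))" "critical_point R x1 y1"
    then show "P x1" using attained by blast
  next
    fix v assume crit: "\<forall>x1 y1. critical_point R x1 y1 \<longrightarrow> P x1" and "v \<in> S2"
    then obtain x1 y1 where "critical_point R x1 y1" "x1 \<le> v \<bullet> (R *v v)"
      using minimum by blast
    then show "P (v \<bullet> (R *v v))" using crit mono by blast
  qed
  from this[of "\<lambda>s. s > 0"] this[of "\<lambda>s. s \<ge> 0"] show ?thesis
    unfolding sectionally_positive_def sectionally_nonnegative_def by simp
qed

end
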